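(* Let $\mathcal{S}$ be a set of $v$ (distinct) points in the tropical plane $\mathbb{R}^2$, where $v \geq 4$, and let $b$ denote the number of stable tropical lines determined by the points of $\mathcal{S}$. Then: (1) $b \geq v-3$; (2) if $b = v-3$, then $\mathcal{S}$ forms a tropical near-pencil.
   Context: Tropical lines. We use the max convention. The tropical line with vertex $p\in\mathbb{R}^2$ is the union of the three closed rays emanating from $p$ in the directions $(-1,0)$, $(0,-1)$, $(1,1)$; it is the locus where the maximum in $\max(a+x,\,b+y,\,c)$ is attained at least twice, with $p=(c-a,c-b)$, $a,b,c\in\mathbb{R}$. Stable tropical lines. Let $L$ be a tropical line and $p_1,\dots,p_k$ ($k\ge 2$) points on $L$. Then $(L,p_1,\dots,p_k)$ is called stable if either $L$ is the unique tropical line passing through all of $p_1,\dots,p_k$, or one of the points $p_1,\dots,p_k$ is the vertex of $L$. A stable tropical line determined by a finite set $\mathcal{S}$ is a tropical line $L$ containing at least two points of $\mathcal{S}$ such that $L$ together with the points of $\mathcal{S}$ on it is stable. The number of stable tropical lines determined by $\mathcal{S}$ is the number of distinct such lines $L$. Tropical line arrangements and dual Newton subdivisions. A tropical line arrangement is a finite collection of distinct tropical lines in $\mathbb{R}^2$. If the lines $l_1,\dots,l_n$ are defined by tropical polynomials $f_i=\max(a_i+x,b_i+y,c_i)$, the dual Newton subdivision of the arrangement is the regular subdivision of the Newton polygon $\mathrm{conv}\{(0,0),(n,0),(0,n)\}$ dual to the tropical curve $l_1\cup\dots\cup l_n$ defined by the tropical product $f_1\odot\cdots\odot f_n=f_1+\dots+f_n$.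 Explicitly, for $w\in\mathbb{R}^2$ let $\Delta_i(w)$ be the convex hull of those exponents among $(1,0),(0,1),(0,0)$ of the terms $a_i+x,\ b_i+y,\ c_i$ whose term attains the maximum in $f_i$ at $w$; the faces (two-dimensional cells) of the subdivision are the two-dimensional polygons among the Minkowski sums $\Delta_1(w)+\dots+\Delta_n(w)$, $w\in\mathbb{R}^2$. A triangular face is a face which is a triangle. Near-pencils. A tropical line arrangement is a tropical near-pencil arrangement if every triangular face of its dual Newton subdivision has at least one edge lying on the boundary of the Newton polygon. The line arrangement dual to a point set $\mathcal{S}$ consists of the tropical lines with vertices $-P$, $P\in\mathcal{S}$. The set $\mathcal{S}$ forms a tropical near-pencil if its dual tropical line arrangement is a tropical near-pencil arrangement. *)

theory Defs
  imports "HOL-Analysis.Analysis"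
begin

type_synonym point = "real \<times> real"

definition trop_line :: "point \<Rightarrow> point set" where
  "trop_line p =
     {p + t *\<^sub>R (-1, 0) |t. t \<ge> 0} \<union> {p + t *\<^sub>R (0, -1) |t. t \<ge> 0} \<union> {p + t *\<^sub>R (1, 1) |t. t \<ge> 0}"

definition is_trop_line :: "point set \<Rightarrow> bool" where
  "is_trop_line L \<longleftrightarrow> (\<exists>p. L = trop_line p)"

definition trop_vertex :: "point set \<Rightarrow> point" where
  "trop_vertex L = (THE p. L = trop_line p)"

(* The exponents of those terms of max(a + x, b + y, c) that attain the maximum at w. *)
definition max_exponents :: "real \<Rightarrow> real \<Rightarrow> real \<Rightarrow> point \<Rightarrow> point set" where
  "max_exponents a b c w =
     (let m = max (a + fst w) (max (b + snd w) c) in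
       {e. e = (1, 0) \<and> a + fst w = m \<or> e = (0, 1) \<and> b + snd w = m \<or> e = (0, 0) \<and> c = m})"

definition trop_locus :: "real \<Rightarrow> real \<Rightarrow> real \<Rightarrow> point set" where
  "trop_locus a b c = {w. card (max_exponents a b c w) \<ge> 2}"

definition stable :: "point set \<Rightarrow> point set \<Rightarrow> bool" where
  "stable L P \<longleftrightarrow>
     is_trop_line L \<and> P \<subseteq> L \<and> finite P \<and> card P \<ge> 2 \<and>
     ((\<forall>L'. is_trop_line L' \<and> P \<subseteq> L' \<longrightarrow> L' = L) \<or> trop_vertex L \<in> P)"

definition stable_lines :: "point set \<Rightarrow> point set set" where
  "stable_lines S = {L. is_trop_line L \<and> card (S \<inter> L) \<ge> 2 \<and> stable L (S \<inter> L)}"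

definition trop_arrangement :: "point set set \<Rightarrow> bool" where
  "trop_arrangement A \<longleftrightarrow> finite A \<and> (\<forall>L\<in>A. is_trop_line L)"

(* The polynomial defining L is only unique up to adding a constant; we take the one with
   constant term 0.  By dual_cell_eq below, the cell does not depend on this choice. *)
definition dual_cell :: "point set \<Rightarrow> point \<Rightarrow> point set" where
  "dual_cell L w = convex hull max_exponents (- fst (trop_vertex L)) (- snd (trop_vertex L)) 0 w"

(* The sum of sets is the Minkowski sum. *)
definition newton_faces :: "point set set \<Rightarrow> point set set" where
  "newton_faces A = {F. (\<exists>w. F = (\<Sum>L\<in>A. dual_cell L w)) \<and> aff_dim F = 2}"

definition newton_polygon :: "point set set \<Rightarrow> point set" where
  "newton_polygon A = convex hull {(0, 0), (real (card A), 0), (0, real (card A))}"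

definition near_pencil_arrangement :: "point set set \<Rightarrow> bool" where
  "near_pencil_arrangement A \<longleftrightarrow>
     trop_arrangement A \<and>
     (\<forall>F\<in>newton_faces A. 2 simplex F \<longrightarrow>
        (\<exists>e. e edge_of F \<and> e \<subseteq> frontier (newton_polygon A)))"

definition dual_arrangement :: "point set \<Rightarrow> point set set" where
  "dual_arrangement S = (\<lambda>P. trop_line (- P)) ` S"

definition near_pencil :: "point set \<Rightarrow> bool" where
  "near_pencil S \<longleftrightarrow> near_pencil_arrangement (dual_arrangement S)"

lemma mem_trop_line_iff:
  "w \<in> trop_line p \<longleftrightarrow>
     (snd w = snd p \<and> fst w \<le> fst p) \<or> (fst w = fst p \<and> snd w \<le> snd p) \<or>
     (fst w - fst p = snd w - snd p \<and> fst p \<le> fst w)"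
proof -
  obtain x y where w: "w = (x, y)" by (cases w)
  obtain p1 p2 where p: "p = (p1, p2)" by (cases p)
  have 1: "w \<in> {p + t *\<^sub>R (-1, 0) |t. t \<ge> 0} \<longleftrightarrow> y = p2 \<and> x \<le> p1"
    unfolding w p by (auto intro!: exI[of _ "p1 - x"])
  have 2: "w \<in> {p + t *\<^sub>R (0, -1) |t. t \<ge> 0} \<longleftrightarrow> x = p1 \<and> y \<le> p2"
    unfolding w p by (auto intro!: exI[of _ "p2 - y"])
  have 3: "w \<in> {p + t *\<^sub>R (1, 1) |t. t \<ge> 0} \<longleftrightarrow> x - p1 = y - p2 \<and> p1 \<le> x"
    unfolding w p by (auto intro!: exI[of _ "x - p1"])
  show ?thesis unfolding trop_line_def Un_iff 1 2 3 by (simp add: w p)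
qed

lemma trop_line_inj: "trop_line p = trop_line q \<longleftrightarrow> p = q"
proof
  assume eq: "trop_line p = trop_line q"
  have m: "(w \<in> trop_line p) = (w \<in> trop_line q)" for w using eq by simp
  define M where "M = \<bar>fst p - fst q\<bar> + \<bar>snd p - snd q\<bar> + 1"
  have "(fst p - M, snd p) \<in> trop_line p" "(fst p, snd p - M) \<in> trop_line p"
    unfolding mem_trop_line_iff M_def fst_conv snd_conv by linarith+
  then have "(fst p - M, snd p) \<in> trop_line q" "(fst p, snd p - M) \<in> trop_line q"
    by (simp_all add: m)
  then have "snd p = snd q" "fst p = fst q"
    unfolding mem_trop_line_iff M_def fst_conv snd_conv by linarith+
  then show "p = q" by (simp add: prod_eq_iff)
qed simp

lemma trop_vertex_trop_line [simp]: "trop_vertex (trop_line p) = p"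
  unfolding trop_vertex_def by (rule the_equality) (simp_all add: trop_line_inj)

lemma trop_locus_eq_trop_line: "trop_locus a b c = trop_line (c - a, c - b)"
proof (intro set_eqI)
  fix w :: point
  define m where "m = max (a + fst w) (max (b + snd w) c)"
  have E: "max_exponents a b c w =
      (if a + fst w = m then {(1, 0)} else {}) \<union> (if b + snd w = m then {(0, 1)} else {}) \<union>
      (if c = m then {(0, 0)} else {})"
    unfolding max_exponents_def Let_def m_def[symmetric] by auto
  show "w \<in> trop_locus a b c \<longleftrightarrow> w \<in> trop_line (c - a, c - b)"
    unfolding trop_locus_def mem_Collect_eq E mem_trop_line_iff
    by (auto simp: m_def max_def)
qed

lemma dual_cell_eq: "dual_cell (trop_locus a b c) w = convex hull max_exponents a b c w"
proof -
  have "max_exponents (a - c) (b - c) 0 w = max_exponents a b c w"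
    unfolding max_exponents_def Let_def by (rule Collect_cong) (auto simp: max_def)
  then show ?thesis
    by (simp add: dual_cell_def trop_locus_eq_trop_line)
qed

end

theory Submission
  imports Defs
begin

text \<open>The plane carries three linear coordinates with sum 0, indexed by \<open>k\<close> modulo 3, such that the tropical line with
vertex \<open>u\<close> consists of \<open>u\<close> and three rays \<open>ray k u\<close>, separating three sectors \<open>sector k u\<close>.
Call \<open>P\<close> in \<open>S\<close> isolated if no other point of \<open>S\<close> lies on the tropical line with vertex \<open>P\<close>, and call \<open>u\<close>
outside \<open>S\<close> a crossing if exactly two of its rays contain points of \<open>S\<close>. The lines whose vertices are
the non-isolated points and the crossings are stable and distinct. So the first claim follows once it is
known that the isolated points outnumber the crossings by at most 3.

The comparison takes place in the regions of the plane on which the way the sectors distribute \<open>S\<close> is constant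
(dually, at the vertices of the Newton subdivision). If all three classes are
nonempty, such a region is a hexagon, some of whose sides may be degenerate, and
its corners alternate between two kinds. An isolated point is a proper corner of the first kind of the
regions around it, and every proper corner of the second kind is a crossing (\<open>crossing_at_chamber_corner\<close>).
Two neighbouring sides never degenerate together, so a degenerate side destroys one corner of each kind, and the
proper corners of the two kinds are equally many. Since the region can be
recovered from a crossing, this gives an injection into the crossings from the pairs of an isolated point and
a bounded region around it (\<open>card_open_corners_le\<close>). At most three isolated points
can lack a bounded region, namely those having all other points in one sector; and an isolated point with
points in all three sectors has three bounded regions. So \<open>b \<ge> v - 3\<close>, and
the inequality is strict unless every isolated point has an empty sector.

It remains to translate the last condition. A triangle has no segment as a Minkowski summand
(\<open>triangle_no_segment_summand\<close>), so the triangular faces of the dual subdivision are the unit triangles belonging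
to isolated points, and an empty sector of the point puts a side of its triangle
on the boundary of the Newton polygon (\<open>near_pencil_if_empty_sectors\<close>).\<close>

section \<open>Triangular coordinates\<close>

lemma three_numerals: "(3 :: 3) = 0" "(4 :: 3) = 1"
  by simp_all

lemma three_exhaust: "k = 0 \<or> k = 1 \<or> k = 2" for k :: 3
  using exhaust_3[of k] by (elim disjE) simp_all

lemma three_cases: "i = k \<or> i = k + 1 \<or> i = k + 2" for i k :: 3
  using three_exhaust[of i] three_exhaust[of k] by (elim disjE) simp_all

lemma three_shift_simps [simp]:
  fixes k :: 3
  shows "k + 1 + 1 = k + 2" "k + 1 + 2 = k" "k + 2 + 1 = k" "k + 2 + 2 = k + 1"
    "k + 1 \<noteq> k" "k + 2 \<noteq> k" "k + 2 \<noteq> k + 1" "k \<noteq> k + 1" "k \<noteq> k + 2" "k + 1 \<noteq> k + 2"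
  using three_exhaust[of k] by (elim disjE; simp)+

text \<open>Three linear forms on the plane with sum 0, indexed modulo 3 so that the three rays of a
tropical line, and the three sectors that they bound, are cyclic shifts of one another.\<close>

definition tcoord :: "3 \<Rightarrow> point \<Rightarrow> real" where
  "tcoord k p = (if k = 0 then fst p - snd p else if k = 1 then snd p else - fst p)"

text \<open>The open ray of the tropical line with vertex \<open>u\<close> along which \<open>tcoord k\<close> is constant: the left ray for
\<open>k = 1\<close>, the lower one for \<open>k = 2\<close> and the diagonal one for \<open>k = 0\<close>.\<close>

definition ray :: "3 \<Rightarrow> point \<Rightarrow> point set" where
  "ray k u = {Q. tcoord k Q = tcoord k u \<and> tcoord (k + 1) u < tcoord (k + 1) Q}"

text \<open>The open sector of the complement of the tropical line with vertex \<open>u\<close> that lies between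
\<open>ray (k + 1) u\<close> and \<open>ray k u\<close>.\<close>

definition sector :: "3 \<Rightarrow> point \<Rightarrow> point set" where
  "sector k u = {Q. tcoord k Q < tcoord k u \<and> tcoord (k + 1) u < tcoord (k + 1) Q}"

lemma tcoord_sum: "tcoord k p + tcoord (k + 1) p + tcoord (k + 2) p = 0"
  using three_exhaust[of k] by (elim disjE) (simp_all add: tcoord_def)

lemma tcoord_eqI: "tcoord k p = tcoord k q \<Longrightarrow> tcoord (k + 1) p = tcoord (k + 1) q \<Longrightarrow> p = q"
  using three_exhaust[of k] by (elim disjE) (simp_all add: tcoord_def prod_eq_iff)

lemma tcoord_surj: "\<exists>p. tcoord k p = s \<and> tcoord (k + 1) p = t"
proof -
  have "\<exists>p. tcoord 1 p = s \<and> tcoord 2 p = t" for s t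
    by (rule exI[of _ "(- t, s)"]) (simp add: tcoord_def)
  moreover have "\<exists>p. tcoord 2 p = s \<and> tcoord 0 p = t" for s t
    by (rule exI[of _ "(- s, - s - t)"]) (simp add: tcoord_def)
  moreover have "\<exists>p. tcoord 0 p = s \<and> tcoord 1 p = t" for s t
    by (rule exI[of _ "(s + t, t)"]) (simp add: tcoord_def)
  ultimately show ?thesis using three_exhaust[of k] by (elim disjE) (simp_all add: three_numerals del: split_paired_Ex)
qed

lemma ex_three: "(\<exists>k :: 3. A k) \<longleftrightarrow> A 0 \<or> A 1 \<or> A 2"
  using three_exhaust by metis

lemma trop_line_eq_rays: "trop_line u = insert u (\<Union>k. ray k u)"
  unfolding set_eq_iff mem_trop_line_iff insert_iff UN_iff bex_UNIV ex_three ray_def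
    prod_eq_iff mem_Collect_eq
  by (auto simp: tcoord_def three_numerals)

text \<open>The three coordinates of \<open>Q - u\<close> sum to 0. Unless they all vanish, one of them is positive and comes, in
cyclic order, directly after one that is not. Together with the three uniqueness lemmas below it makes the rays, the sectors and the
vertex a partition of the plane.\<close>

lemma ray_or_sector: "Q = u \<or> (\<exists>i. Q \<in> ray i u) \<or> (\<exists>i. Q \<in> sector i u)"
proof -
  define d where "d i = tcoord i Q - tcoord i u" for i
  have sum: "d 0 + d 1 + d 2 = 0" using tcoord_sum[of 0 Q] tcoord_sum[of 0 u] by (simp add: d_def)
  have ray: "Q \<in> ray i u \<longleftrightarrow> d i = 0 \<and> 0 < d (i + 1)" for i by (auto simp: ray_def d_def)
  have sector: "Q \<in> sector i u \<longleftrightarrow> d i < 0 \<and> 0 < d (i + 1)" for i by (auto simp: sector_def d_def)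
  have eq: "Q = u" if "d 0 = 0" "d 1 = 0" using tcoord_eqI[of 0 Q u] that by (simp add: d_def)
  show ?thesis
    unfolding ex_three ray sector using sum eq by (simp add: three_numerals) linarith
qed

lemma sector_unique: "Q \<in> sector i u \<Longrightarrow> Q \<in> sector j u \<Longrightarrow> i = j"
  using three_cases[of j i] by (elim disjE) (simp_all add: sector_def)

lemma ray_unique: "Q \<in> ray i u \<Longrightarrow> Q \<in> ray j u \<Longrightarrow> i = j"
  using three_cases[of j i] tcoord_sum[of i Q] tcoord_sum[of i u] by (elim disjE) (simp_all add: ray_def)

lemma sector_not_ray: "Q \<in> sector i u \<Longrightarrow> Q \<notin> ray j u"
  using three_cases[of j i] tcoord_sum[of i Q] tcoord_sum[of i u]
  by (elim disjE) (simp_all add: ray_def sector_def)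

text \<open>Two points on different rays are in general position, which is what makes a line through them stable
even when its vertex is not one of the given points.\<close>

lemma trop_line_unique:
  assumes p: "p \<in> ray j u" and q: "q \<in> ray (j + 1) u"
    and "p \<in> trop_line u'" "q \<in> trop_line u'"
  shows "u' = u"
proof -
  have closed: "\<exists>i. tcoord i x = tcoord i u' \<and> tcoord (i + 1) u' \<le> tcoord (i + 1) x" if "x \<in> trop_line u'" for x
    using that by (auto simp: trop_line_eq_rays ray_def intro: less_imp_le)
  obtain i i' where i: "tcoord i p = tcoord i u'" "tcoord (i + 1) u' \<le> tcoord (i + 1) p"
    and i': "tcoord i' q = tcoord i' u'" "tcoord (i' + 1) u' \<le> tcoord (i' + 1) q"
    using closed assms(3,4) by meson
  have *: "tcoord j p = tcoord j u" "tcoord (j + 1) u < tcoord (j + 1) p"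
    "tcoord (j + 1) q = tcoord (j + 1) u" "tcoord (j + 2) u < tcoord (j + 2) q"
    using p q by (auto simp: ray_def)
  have "tcoord j u' = tcoord j u \<and> tcoord (j + 1) u' = tcoord (j + 1) u"
    using three_cases[of i j] three_cases[of i' j] i i' *
      tcoord_sum[of j p] tcoord_sum[of j q] tcoord_sum[of j u] tcoord_sum[of j u']
    by (elim disjE; simp; linarith)
  then show ?thesis by (blast intro: tcoord_eqI)
qed

section \<open>Stable lines\<close>

text \<open>A stable line whose vertex is not in \<open>S\<close> is determined by the set of points of \<open>S\<close> on it. Without
finiteness the cardinality of the set of stable lines would be 0 and no lower bound could hold.\<close>

lemma finite_stable_lines:
  assumes "finite S"
  shows "finite (stable_lines S)"
proof -
  define X where "X = {L \<in> stable_lines S. trop_vertex L \<notin> S}"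
  have "inj_on (\<lambda>L. S \<inter> L) X"
    unfolding inj_on_def X_def stable_lines_def stable_def by blast
  moreover have "(\<lambda>L. S \<inter> L) ` X \<subseteq> Pow S" by auto
  ultimately have "finite X"
    using assms by (meson finite_Pow_iff finite_imageD finite_subset)
  moreover have "stable_lines S \<subseteq> X \<union> trop_line ` S"
  proof
    fix L assume L: "L \<in> stable_lines S"
    then obtain p where "L = trop_line p"
      by (auto simp: stable_lines_def is_trop_line_def)
    then show "L \<in> X \<union> trop_line ` S"
      using L by (auto simp: X_def)
  qed
  ultimately show ?thesis using assms by (meson finite_UnI finite_imageI finite_subset)
qed

definition isolated :: "point set \<Rightarrow> point \<Rightarrow> bool" where
  "isolated S u \<longleftrightarrow> (\<forall>i. S \<inter> ray i u = {})"

text \<open>The vertices outside \<open>S\<close> of those stable lines that have points of \<open>S\<close> on exactly two rays. Dually,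
these are the parallelograms of the subdivision. If there are points on all three rays, then the dual cell is a hexagon and every
region of test points around the vertex has an angle of 60 degrees there, whereas the corners compared below have
120 degrees.\<close>

definition crossing :: "point set \<Rightarrow> 3 \<Rightarrow> point \<Rightarrow> bool" where
  "crossing S j u \<longleftrightarrow> u \<notin> S \<and> S \<inter> ray j u \<noteq> {} \<and> S \<inter> ray (j + 1) u \<noteq> {} \<and> S \<inter> ray (j + 2) u = {}"

lemma two_le_card: "finite A \<Longrightarrow> x \<in> A \<Longrightarrow> y \<in> A \<Longrightarrow> x \<noteq> y \<Longrightarrow> 2 \<le> card A"
  using card_mono[of A "{x, y}"] by auto

lemma stable_line_at_point:
  assumes "finite S" "P \<in> S" "\<not> isolated S P"
  shows "trop_line P \<in> stable_lines S"
proof -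
  obtain Q i where Q: "Q \<in> S" "Q \<in> ray i P" using assms by (auto simp: isolated_def)
  have "2 \<le> card (S \<inter> trop_line P)"
    using assms Q by (intro two_le_card[of _ P Q]) (auto simp: trop_line_eq_rays ray_def)
  moreover have "is_trop_line (trop_line P)" unfolding is_trop_line_def by blast
  moreover have "P \<in> trop_line P" by (simp add: trop_line_eq_rays)
  ultimately show ?thesis
    using assms(1,2) by (simp add: stable_lines_def stable_def)
qed

lemma stable_line_at_crossing:
  assumes "finite S" "crossing S j u"
  shows "trop_line u \<in> stable_lines S"
proof -
  obtain p q where p: "p \<in> S" "p \<in> ray j u" and q: "q \<in> S" "q \<in> ray (j + 1) u"
    using assms by (auto simp: crossing_def)
  have pq: "p \<in> S \<inter> trop_line u" "q \<in> S \<inter> trop_line u"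
    using p q by (auto simp: trop_line_eq_rays)
  have "p \<noteq> q" using p q by (auto simp: ray_def)
  then have "2 \<le> card (S \<inter> trop_line u)"
    using assms(1) pq by (intro two_le_card[of _ p q]) auto
  moreover have "L' = trop_line u" if "is_trop_line L'" "S \<inter> trop_line u \<subseteq> L'" for L'
    using that pq p q trop_line_unique unfolding is_trop_line_def by blast
  moreover have "is_trop_line (trop_line u)" unfolding is_trop_line_def by blast
  ultimately show ?thesis
    using assms(1) unfolding stable_lines_def stable_def by blast
qed

section \<open>Chambers\<close>

text \<open>A partition \<open>T\<close> of \<open>S\<close> into three classes determines the open region of those test points that
see each class \<open>T k\<close> in their sector \<open>k\<close>. If no class is empty, it is given by the
inequalities \<open>low T k < tcoord k r < high T k\<close>, so it is a bounded hexagon whose sides, some of them possibly degenerate, lie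
in cyclic order on the lines \<open>tcoord k = low T k\<close>, \<open>tcoord (k + 1) = high T (k + 1)\<close>, \<open>tcoord (k + 2) = low T (k + 2)\<close>,
\<open>tcoord k = high T k\<close>, \<open>tcoord (k + 1) = low T (k + 1)\<close>, \<open>tcoord (k + 2) = high T (k + 2)\<close>.\<close>

definition low :: "(3 \<Rightarrow> point set) \<Rightarrow> 3 \<Rightarrow> real" where
  "low T k = Max (tcoord k ` T k)"

definition high :: "(3 \<Rightarrow> point set) \<Rightarrow> 3 \<Rightarrow> real" where
  "high T k = Min (tcoord k ` T (k + 2))"

text \<open>For a nonempty region, the condition that its side on the line \<open>tcoord k = low T k\<close> is not degenerate:
on that line the other two coordinates sum to \<open>- low T k\<close>, which has to stay below the sum
of their upper bounds. Similarly for \<open>high_edge\<close>.\<close>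

definition low_edge :: "(3 \<Rightarrow> point set) \<Rightarrow> 3 \<Rightarrow> bool" where
  "low_edge T k \<longleftrightarrow> low T k + high T (k + 1) + high T (k + 2) > 0"

definition high_edge :: "(3 \<Rightarrow> point set) \<Rightarrow> 3 \<Rightarrow> bool" where
  "high_edge T k \<longleftrightarrow> high T k + low T (k + 1) + low T (k + 2) < 0"

text \<open>The partition belonging to the region that has the isolated point \<open>P\<close> as its corner between the sides
\<open>tcoord k = low\<close> and \<open>tcoord (k + 1) = high\<close>: test points of the region close to \<open>P\<close> have \<open>P\<close> itself in sector \<open>k\<close>
and every other point where \<open>P\<close> has it.\<close>

definition point_chamber :: "point set \<Rightarrow> point \<Rightarrow> 3 \<Rightarrow> 3 \<Rightarrow> point set" where
  "point_chamber S P k i = (S \<inter> sector i P) \<union> (if i = k then {P} else {})"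

text \<open>The partition belonging to the region that has the crossing \<open>u\<close> as its corner between the sides
\<open>tcoord j = high\<close> and \<open>tcoord (j + 1) = low\<close>: moving \<open>u\<close> into that region decreases \<open>tcoord j\<close> and increases \<open>tcoord (j + 1)\<close>,
which pushes the points on \<open>ray j u\<close> into sector \<open>j + 2\<close> and those on \<open>ray (j + 1) u\<close> into sector \<open>j + 1\<close>.\<close>

definition crossing_chamber :: "point set \<Rightarrow> point \<Rightarrow> 3 \<Rightarrow> 3 \<Rightarrow> point set" where
  "crossing_chamber S u j i = S \<inter>
     (sector i u \<union> (if i = j + 1 then ray (j + 1) u else if i = j + 2 then ray j u else {}))"

lemma mem_crossing_chamber:
  "Q \<in> crossing_chamber S u j i \<longleftrightarrow> Q \<in> S \<and>
     (Q \<in> sector i u \<or> i = j + 1 \<and> Q \<in> ray (j + 1) u \<or> i = j + 2 \<and> Q \<in> ray j u)"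
  by (simp add: crossing_chamber_def)

lemma low_high_bounds:
  assumes "finite (T i)" "Q \<in> T i"
  shows "tcoord i Q \<le> low T i" "high T (i + 1) \<le> tcoord (i + 1) Q"
  using assms by (auto simp: low_def high_def)

lemma low_attained: "finite (T i) \<Longrightarrow> T i \<noteq> {} \<Longrightarrow> \<exists>Q\<in>T i. tcoord i Q = low T i"
  unfolding low_def using Max_in[of "tcoord i ` T i"] by fastforce

lemma high_attained: "finite (T i) \<Longrightarrow> T i \<noteq> {} \<Longrightarrow> \<exists>Q\<in>T i. tcoord (i + 1) Q = high T (i + 1)"
  unfolding high_def using Min_in[of "tcoord (i + 1) ` T i"] by fastforce

lemma crossing_chamber_unique:
  assumes "Q \<in> crossing_chamber S u j i" "Q \<in> crossing_chamber S u j i'"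
  shows "i = i'"
  using assms sector_unique[of Q i u i'] sector_not_ray[of Q i u] sector_not_ray[of Q i' u]
    ray_unique[of Q j u "j + 1"]
  unfolding mem_crossing_chamber by auto

text \<open>A corner of a region between two nondegenerate sides \<open>tcoord j = high\<close> and \<open>tcoord (j + 1) = low\<close> is a crossing,
because each of these sides is cut out by a point of \<open>S\<close>, seen from the corner on \<open>ray j\<close> and
\<open>ray (j + 1)\<close> respectively, while the third coordinate is strictly within its bounds. It is not
in \<open>S\<close>: the test points that see a given point of \<open>S\<close> in a fixed sector form a sector of 120 degrees at that
point, and this corner has the same angle but the opposite orientation. The region can be read off from the crossing.\<close>

lemma crossing_at_chamber_corner:
  assumes S: "S = (\<Union>i. T i)"
    and fin: "\<And>i. finite (T i)" and ne: "\<And>i. T i \<noteq> {}"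
    and lh: "\<And>i. low T i < high T i"
    and edges: "high_edge T j" "low_edge T (j + 1)"
  shows "\<exists>u. crossing S j u \<and> crossing_chamber S u j = T"
proof -
  obtain u where u: "tcoord j u = high T j" "tcoord (j + 1) u = low T (j + 1)"
    using tcoord_surj by blast
  have u2: "low T (j + 2) < tcoord (j + 2) u" "tcoord (j + 2) u < high T (j + 2)"
    using tcoord_sum[of j u] edges u by (auto simp: low_edge_def high_edge_def)
  have T0: "tcoord j Q < tcoord j u \<and> tcoord (j + 1) u < tcoord (j + 1) Q" if "Q \<in> T j" for Q
    using low_high_bounds[of T j Q, OF fin that] lh[of j] lh[of "j + 1"] u by auto
  have T1: "tcoord (j + 1) Q \<le> tcoord (j + 1) u \<and> tcoord (j + 2) u < tcoord (j + 2) Q" if "Q \<in> T (j + 1)" for Q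
    using low_high_bounds[of T "j + 1" Q, OF fin that] u u2 by auto
  have T2: "tcoord (j + 2) Q < tcoord (j + 2) u \<and> tcoord j u \<le> tcoord j Q" if "Q \<in> T (j + 2)" for Q
    using low_high_bounds[of T "j + 2" Q, OF fin that] u u2 by auto
  \<comment> \<open>Points with \<open>tcoord j Q = tcoord j u\<close> are the ones that cut out the side \<open>tcoord j = high\<close>.\<close>
  have T2': "Q \<in> ray j u" if "Q \<in> T (j + 2)" "tcoord j Q = tcoord j u" for Q
    using T2[OF that(1)] that(2) tcoord_sum[of j u] tcoord_sum[of j Q] by (auto simp: ray_def)
  have sub: "Q \<in> crossing_chamber S u j i" if Q: "Q \<in> T i" for Q i
  proof -
    have "Q \<in> S" using Q S by blast
    consider "i = j" | "i = j + 1" | "i = j + 2" using three_cases by blast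
    then show ?thesis
    proof cases
      case 1
      then show ?thesis using T0 Q \<open>Q \<in> S\<close> by (simp add: mem_crossing_chamber sector_def)
    next
      case 2
      then show ?thesis using T1[of Q] Q \<open>Q \<in> S\<close>
        by (auto simp: mem_crossing_chamber sector_def ray_def)
    next
      case 3
      then show ?thesis using T2[of Q] T2'[of Q] Q \<open>Q \<in> S\<close>
        by (cases "tcoord j Q = tcoord j u") (simp_all add: mem_crossing_chamber sector_def)
    qed
  qed
  have eq: "crossing_chamber S u j i = T i" for i
  proof
    show "T i \<subseteq> crossing_chamber S u j i" using sub by blast
    show "crossing_chamber S u j i \<subseteq> T i"
    proof
      fix Q assume Q: "Q \<in> crossing_chamber S u j i"
      then obtain i' where "Q \<in> T i'" using S by (auto simp: mem_crossing_chamber)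
      then show "Q \<in> T i" using Q sub crossing_chamber_unique by metis
    qed
  qed
  have "u \<notin> S"
  proof
    assume "u \<in> S"
    then obtain i where "u \<in> crossing_chamber S u j i" using S eq by auto
    then show False by (simp add: mem_crossing_chamber sector_def ray_def)
  qed
  moreover have "S \<inter> ray (j + 2) u = {}"
  proof (rule equals0I)
    fix Q assume "Q \<in> S \<inter> ray (j + 2) u"
    then obtain i where "Q \<in> crossing_chamber S u j i" "Q \<in> ray (j + 2) u" using S eq by auto
    then show False
      using ray_unique[of Q "j + 2" u j] ray_unique[of Q "j + 2" u "j + 1"]
        sector_not_ray[of Q i u "j + 2"]
      unfolding mem_crossing_chamber by auto
  qed
  moreover have "S \<inter> ray (j + 1) u \<noteq> {}"
  proof -
    obtain Q where "Q \<in> T (j + 1)" "tcoord (j + 1) Q = low T (j + 1)"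
      using low_attained[of T "j + 1"] fin ne by blast
    then have "Q \<in> S \<inter> ray (j + 1) u" using T1 u S by (auto simp: ray_def)
    then show ?thesis by blast
  qed
  moreover have "S \<inter> ray j u \<noteq> {}"
  proof -
    obtain Q where "Q \<in> T (j + 2)" "tcoord j Q = high T j"
      using high_attained[of T "j + 2"] fin ne by auto
    then have "Q \<in> S \<inter> ray j u" using T2' u S by auto
    then show ?thesis by blast
  qed
  moreover have "crossing_chamber S u j = T" using eq by (rule ext)
  ultimately show ?thesis unfolding crossing_def by blast
qed

text \<open>An isolated point \<open>P\<close> is a corner of three regions, one for each \<open>k\<close>; the two sectors of \<open>P\<close> other than
\<open>k\<close> must contain points for that region to be bounded.\<close>

definition open_corner :: "point set \<Rightarrow> point \<Rightarrow> 3 \<Rightarrow> bool" where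
  "open_corner S P k \<longleftrightarrow> P \<in> S \<and> isolated S P \<and> S \<inter> sector (k + 1) P \<noteq> {} \<and> S \<inter> sector (k + 2) P \<noteq> {}"

lemma
  assumes fin: "finite S" and P: "open_corner S P k"
  defines "T \<equiv> point_chamber S P k"
  shows point_chamber_cover: "S = (\<Union>i. T i)"
    and point_chamber_finite: "\<And>i. finite (T i)"
    and point_chamber_nonempty: "\<And>i. T i \<noteq> {}"
    and point_chamber_low: "low T k = tcoord k P"
    and point_chamber_high: "high T (k + 1) = tcoord (k + 1) P"
    and point_chamber_less: "\<And>i. low T i < high T i"
    and point_chamber_low_edge: "low_edge T k"
    and point_chamber_high_edge: "high_edge T (k + 1)"
proof -
  have T: "T k = insert P (S \<inter> sector k P)"
    "T (k + 1) = S \<inter> sector (k + 1) P" "T (k + 2) = S \<inter> sector (k + 2) P"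
    by (auto simp: T_def point_chamber_def)
  have PS: "P \<in> S" and iso: "\<And>Q i. Q \<in> S \<Longrightarrow> Q \<notin> ray i P"
    using P by (auto simp: open_corner_def isolated_def)
  show cover: "S = (\<Union>i. T i)"
  proof
    show "S \<subseteq> (\<Union>i. T i)"
    proof
      fix Q assume Q: "Q \<in> S"
      then have "Q = P \<or> (\<exists>i. Q \<in> sector i P)" using ray_or_sector iso by blast
      then show "Q \<in> (\<Union>i. T i)" using Q T by (auto simp: T_def point_chamber_def)
    qed
  qed (auto simp: T_def point_chamber_def PS split: if_splits)
  show finT: "finite (T i)" for i using fin by (auto simp: T_def point_chamber_def)
  show neT: "T i \<noteq> {}" for i
    using three_cases[of i k] P by (elim disjE) (simp_all add: open_corner_def T)
  show lowk: "low T k = tcoord k P"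
    unfolding low_def using finT[of k]
    by (intro Max_eqI) (auto simp: T sector_def intro: less_imp_le)
  show highk: "high T (k + 1) = tcoord (k + 1) P"
    unfolding high_def using finT[of k]
    by (intro Min_eqI) (auto simp: T sector_def intro: less_imp_le)
  have low': "low T i < tcoord i P" if "T i \<subseteq> sector i P" for i
    using low_attained[of T i, OF finT neT] that unfolding sector_def by fastforce
  have high': "tcoord (i + 1) P < high T (i + 1)" if "T i \<subseteq> sector i P" for i
    using high_attained[of T i, OF finT neT] that unfolding sector_def by fastforce
  have a: "low T (k + 1) < tcoord (k + 1) P" "low T (k + 2) < tcoord (k + 2) P"
    using low'[of "k + 1"] low'[of "k + 2"] by (simp_all add: T)
  have b: "tcoord (k + 2) P < high T (k + 2)" "tcoord k P < high T k"
    using high'[of "k + 1"] high'[of "k + 2"] by (simp_all add: T)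
  show "low T i < high T i" for i
    using three_cases[of i k] lowk highk a b by (elim disjE) simp_all
  show "low_edge T k" "high_edge T (k + 1)"
    using lowk highk a b tcoord_sum[of k P] by (auto simp: low_edge_def high_edge_def)
qed

text \<open>The corners of the hexagon alternate between the kind where isolated points sit (\<open>low\<close> meets the next
\<open>high\<close>) and the kind where crossings sit (\<open>high\<close> meets the next \<open>low\<close>). From the corner of the first
kind with index \<open>k\<close>, this walks along the side \<open>tcoord (k + 1) = high\<close> and onwards to the first
corner of the second kind whose sides are not degenerate. Sides next to a degenerate one are
nondegenerate, so a degenerate side removes one corner of each kind and the walk never
passes another proper corner of the first kind.\<close>

definition next_corner :: "(3 \<Rightarrow> point set) \<Rightarrow> 3 \<Rightarrow> 3" where
  "next_corner T k = (if low_edge T (k + 2) then k + 1 else if low_edge T (k + 1) then k else k + 2)"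

lemma next_corner_inj:
  assumes "low_edge T k" "low_edge T k'" "next_corner T k = next_corner T k'"
  shows "k = k'"
  using assms three_cases[of k' k] by (elim disjE) (simp_all add: next_corner_def split: if_splits)

text \<open>If \<open>tcoord i = low\<close> is degenerate, then both of its neighbours \<open>tcoord (i + 1) = high\<close> and \<open>tcoord (i + 2) = high\<close>
are not. This settles the two cases in which the walk has to skip a corner.\<close>

lemma next_corner_edges:
  assumes lh: "\<And>i. low T i < high T i" and "low_edge T k" "high_edge T (k + 1)"
  shows "high_edge T (next_corner T k)" "low_edge T (next_corner T k + 1)"
proof -
  have "high_edge T (i + 1)" "high_edge T (i + 2)" if "\<not> low_edge T i" for i
    using that lh[of "i + 1"] lh[of "i + 2"] by (auto simp: low_edge_def high_edge_def)
  from this[of "k + 1"] this[of "k + 2"]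
  show "high_edge T (next_corner T k)" "low_edge T (next_corner T k + 1)"
    using assms by (auto simp: next_corner_def)
qed

section \<open>Counting stable lines\<close>

lemma crossing_unique: "crossing S j u \<Longrightarrow> crossing S j' u \<Longrightarrow> j = j'"
  using three_cases[of j' j] by (elim disjE) (simp_all add: crossing_def)

text \<open>Sending an isolated point, as a corner of a bounded region, to the next crossing on the boundary of that region
is injective: a crossing is a corner of the second kind for only one region, the walk in
this region is injective on indices, and a region has only one corner of each index.\<close>

lemma card_open_corners_le:
  assumes fin: "finite S"
  shows "card {(P, k). open_corner S P k} \<le> card {u. \<exists>j. crossing S j u}"
    and "finite {u. \<exists>j. crossing S j u}"
proof -
  let ?T = "point_chamber S"
  have "\<exists>u. crossing S (next_corner (?T P k) k) u \<and>
      crossing_chamber S u (next_corner (?T P k) k) = ?T P k" if "open_corner S P k" for P k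
  proof (rule crossing_at_chamber_corner)
    note * = fin that
    show "S = (\<Union>i. ?T P k i)" by (rule point_chamber_cover[OF *])
    show "finite (?T P k i)" for i by (rule point_chamber_finite[OF *])
    show "?T P k i \<noteq> {}" for i by (rule point_chamber_nonempty[OF *])
    show lh: "low (?T P k) i < high (?T P k) i" for i by (rule point_chamber_less[OF *])
    show "high_edge (?T P k) (next_corner (?T P k) k)" "low_edge (?T P k) (next_corner (?T P k) k + 1)"
      using next_corner_edges[of "?T P k" k] lh point_chamber_low_edge[OF *]
        point_chamber_high_edge[OF *] by blast+
  qed
  then obtain g where g: "\<And>P k. open_corner S P k \<Longrightarrow> crossing S (next_corner (?T P k) k) (g P k)"
    "\<And>P k. open_corner S P k \<Longrightarrow> crossing_chamber S (g P k) (next_corner (?T P k) k) = ?T P k"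
    by metis
  have "inj_on (\<lambda>(P, k). g P k) {(P, k). open_corner S P k}"
  proof (rule inj_onI)
    fix x x' assume x: "x \<in> {(P, k). open_corner S P k}" "x' \<in> {(P, k). open_corner S P k}"
      "(case x of (P, k) \<Rightarrow> g P k) = (case x' of (P, k) \<Rightarrow> g P k)"
    then obtain P k P' k' where x_eq: "x = (P, k)" "x' = (P', k')"
      and P: "open_corner S P k" and P': "open_corner S P' k'" by blast
    have eq: "g P k = g P' k'" using x(3) x_eq by simp
    have j: "next_corner (?T P k) k = next_corner (?T P' k') k'"
      using g(1)[OF P] g(1)[OF P'] eq crossing_unique by metis
    then have T: "?T P k = ?T P' k'"
      using g(2)[OF P] g(2)[OF P'] eq by metis
    have k: "k = k'"
      using next_corner_inj[of "?T P k" k k'] j T point_chamber_low_edge[OF fin P]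
        point_chamber_low_edge[OF fin P'] by simp
    have "tcoord k P = tcoord k P'" "tcoord (k + 1) P = tcoord (k + 1) P'"
      using point_chamber_low[OF fin P] point_chamber_low[OF fin P']
        point_chamber_high[OF fin P] point_chamber_high[OF fin P'] T k by simp_all
    then show "x = x'" using k x_eq tcoord_eqI[of k P P'] by simp
  qed
  moreover have "(\<lambda>(P, k). g P k) ` {(P, k). open_corner S P k} \<subseteq> {u. \<exists>j. crossing S j u}"
  proof (rule image_subsetI)
    fix x assume "x \<in> {(P, k). open_corner S P k}"
    then obtain P k where "x = (P, k)" "open_corner S P k" by blast
    then show "(case x of (P, k) \<Rightarrow> g P k) \<in> {u. \<exists>j. crossing S j u}"
      using g(1)[of P k] by auto
  qed
  moreover show "finite {u. \<exists>j. crossing S j u}"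
  proof -
    have "trop_line ` {u. \<exists>j. crossing S j u} \<subseteq> stable_lines S"
      using stable_line_at_crossing[OF fin] by auto
    then have "finite (trop_line ` {u. \<exists>j. crossing S j u})"
      using finite_stable_lines[OF fin] finite_subset by blast
    then show ?thesis by (rule finite_imageD) (auto simp: inj_on_def trop_line_inj)
  qed
  ultimately show "card {(P, k). open_corner S P k} \<le> card {u. \<exists>j. crossing S j u}"
    by (rule card_inj_on_le)
qed

lemma card_stable_lines_ge:
  assumes fin: "finite S"
  shows "card {P \<in> S. \<not> isolated S P} + card {(P, k). open_corner S P k} \<le> card (stable_lines S)"
proof -
  let ?J = "{P \<in> S. \<not> isolated S P}" and ?C = "{u. \<exists>j. crossing S j u}"
  have "card ?J + card {(P, k). open_corner S P k} \<le> card ?J + card ?C"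
    using card_open_corners_le(1)[OF fin] by simp
  also have "\<dots> = card (?J \<union> ?C)"
    using fin card_open_corners_le(2)[OF fin]
    by (intro card_Un_disjoint[symmetric]) (auto simp: crossing_def)
  also have "\<dots> = card (trop_line ` (?J \<union> ?C))"
    by (intro card_image[symmetric]) (auto simp: inj_on_def trop_line_inj)
  also have "\<dots> \<le> card (stable_lines S)"
    using stable_line_at_point[OF fin] stable_line_at_crossing[OF fin]
    by (intro card_mono finite_stable_lines[OF fin]) auto
  finally show ?thesis .
qed

text \<open>\<open>Q \<in> sector i P\<close> is asymmetric in \<open>P\<close> and \<open>Q\<close>, so for each of the three \<open>i\<close> at most one point has all
others in its sector \<open>i\<close>. Dually, these are the triangles at the three corners of
the Newton polygon.\<close>

lemma card_extreme_le:
  fixes S :: "point set"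
  shows "card {P \<in> S. \<exists>i. \<forall>Q \<in> S. Q \<noteq> P \<longrightarrow> Q \<in> sector i P} \<le> 3"
proof -
  define C where "C i = {P \<in> S. \<forall>Q \<in> S. Q \<noteq> P \<longrightarrow> Q \<in> sector i P}" for i
  have one: "P = P'" if "P \<in> C i" "P' \<in> C i" for P P' i
  proof (rule ccontr)
    assume "P \<noteq> P'"
    then have "P \<in> sector i P'" "P' \<in> sector i P" using that by (auto simp: C_def)
    then show False by (auto simp: sector_def)
  qed
  have "card (C i) \<le> 1" for i
  proof (cases "C i = {}")
    case False
    then obtain P where "C i = {P}" using one by blast
    then show ?thesis by simp
  qed simp
  then have "card (\<Union>i. C i) \<le> (\<Sum>i\<in>(UNIV :: 3 set). 1)"
    by (intro order.trans[OF card_UN_le] sum_mono) auto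
  moreover have "{P \<in> S. \<exists>i. \<forall>Q \<in> S. Q \<noteq> P \<longrightarrow> Q \<in> sector i P} = (\<Union>i. C i)"
    by (auto simp: C_def)
  ultimately show ?thesis by simp
qed

lemma extreme_or_open_corner:
  assumes "P \<in> S" "isolated S P"
  shows "(\<exists>i. \<forall>Q \<in> S. Q \<noteq> P \<longrightarrow> Q \<in> sector i P) \<or> (\<exists>k. open_corner S P k)"
proof (rule disjCI)
  assume no: "\<not> (\<exists>k. open_corner S P k)"
  have sec: "\<exists>i. Q \<in> sector i P" if "Q \<in> S" "Q \<noteq> P" for Q
    using that assms ray_or_sector[of Q P] by (auto simp: isolated_def)
  have same: "i = i'" if "Q \<in> S" "Q \<in> sector i P" "Q' \<in> S" "Q' \<in> sector i' P" for Q Q' i i'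
  proof (rule ccontr)
    assume "i \<noteq> i'"
    then have "open_corner S P (i + 1) \<or> open_corner S P (i + 2)"
      using that three_cases[of i' i] assms by (auto simp: open_corner_def)
    then show False using no by blast
  qed
  show "\<exists>i. \<forall>Q \<in> S. Q \<noteq> P \<longrightarrow> Q \<in> sector i P"
    using sec same by metis
qed

text \<open>An isolated point that is not extreme is a corner of a bounded region; one with points in all of its
sectors is a corner of three, which makes the inequality strict.\<close>

lemma card_isolated_le:
  assumes fin: "finite S"
  shows "card {P \<in> S. isolated S P} \<le> card {(P, k). open_corner S P k} + 3"
    and "\<lbrakk>P \<in> S; isolated S P; \<And>i. S \<inter> sector i P \<noteq> {}\<rbrakk> \<Longrightarrow>
      card {P \<in> S. isolated S P} < card {(P, k). open_corner S P k} + 3"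
proof -
  let ?U = "{(P, k). open_corner S P k}"
  let ?E = "{P \<in> S. \<exists>i. \<forall>Q \<in> S. Q \<noteq> P \<longrightarrow> Q \<in> sector i P}"
  have "?U \<subseteq> S \<times> UNIV" by (auto simp: open_corner_def)
  then have finU: "finite ?U" using fin by (meson finite_SigmaI finite_class.finite_UNIV finite_subset)
  have "{P \<in> S. isolated S P} \<subseteq> fst ` ?U \<union> ?E"
    using extreme_or_open_corner by (force simp: image_iff)
  then have "card {P \<in> S. isolated S P} \<le> card (fst ` ?U \<union> ?E)"
    using finU fin by (intro card_mono) auto
  also have "\<dots> \<le> card (fst ` ?U) + card ?E" by (rule card_Un_le)
  finally have le: "card {P \<in> S. isolated S P} \<le> card (fst ` ?U) + 3"
    using card_extreme_le[of S] by simp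
  have le': "card (fst ` ?U) \<le> card ?U" using finU by (rule card_image_le)
  show "card {P \<in> S. isolated S P} \<le> card ?U + 3" using le le' by simp
  show "card {P \<in> S. isolated S P} < card ?U + 3"
    if "P \<in> S" "isolated S P" "\<And>i. S \<inter> sector i P \<noteq> {}"
  proof -
    \<comment> \<open>\<open>P\<close> occurs with more than one index, so fewer points than pairs are available.\<close>
    have "(P, 0) \<in> ?U" "(P, 1) \<in> ?U" using that by (auto simp: open_corner_def)
    then have "\<not> inj_on fst ?U"
      using inj_onD[of fst ?U "(P, 0)" "(P, 1)"] by auto
    then have "card (fst ` ?U) \<noteq> card ?U" using finU eq_card_imp_inj_on by blast
    then show ?thesis using le le' by simp
  qed
qed

lemma card_le_card_stable_lines:
  assumes fin: "finite S"
  shows "card S \<le> card (stable_lines S) + 3"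
    and "\<lbrakk>P \<in> S; isolated S P; \<And>i. S \<inter> sector i P \<noteq> {}\<rbrakk> \<Longrightarrow> card S < card (stable_lines S) + 3"
proof -
  have "S = {P \<in> S. isolated S P} \<union> {P \<in> S. \<not> isolated S P}" by auto
  then have "card S = card {P \<in> S. isolated S P} + card {P \<in> S. \<not> isolated S P}"
    using fin card_Un_disjoint[of "{P \<in> S. isolated S P}" "{P \<in> S. \<not> isolated S P}"] by fastforce
  note count = this card_stable_lines_ge[OF fin]
  show "card S \<le> card (stable_lines S) + 3"
    using count card_isolated_le(1)[OF fin] by linarith
  show "card S < card (stable_lines S) + 3"
    if "P \<in> S" "isolated S P" "\<And>i. S \<inter> sector i P \<noteq> {}"
    using count card_isolated_le(2)[OF fin that] by linarith
qed

section \<open>Triangles as Minkowski sums\<close>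

text \<open>If a translation keeps two vertices inside the triangle, then the barycentric coordinates of the translation
vector are nonnegative, and they sum to 0.\<close>

lemma triangle_translation_trivial:
  fixes a b c d :: "'a::euclidean_space"
  assumes indep: "\<not> affine_dependent {a, b, c}" and dist: "a \<noteq> b" "a \<noteq> c" "b \<noteq> c"
    and a: "a + d \<in> convex hull {a, b, c}" and b: "b + d \<in> convex hull {a, b, c}"
  shows "d = 0"
proof -
  obtain u v w where 1: "a + d = u *\<^sub>R a + v *\<^sub>R b + w *\<^sub>R c"
    "0 \<le> u" "0 \<le> v" "0 \<le> w" "u + v + w = 1"
    using a unfolding convex_hull_3 by blast
  obtain u' v' w' where 2: "b + d = u' *\<^sub>R a + v' *\<^sub>R b + w' *\<^sub>R c"
    "0 \<le> u'" "0 \<le> v'" "0 \<le> w'" "u' + v' + w' = 1"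
    using b unfolding convex_hull_3 by blast
  \<comment> \<open>The affine combination expressing that \<open>a - b\<close> is the difference of the two translated points.\<close>
  define U where "U = (\<lambda>x. if x = a then u - u' - 1 else if x = b then v - v' + 1 else w - w')"
  have "sum U {a, b, c} = 0"
    using dist 1(5) 2(5) by (simp add: U_def)
  moreover have "(\<Sum>x\<in>{a, b, c}. U x *\<^sub>R x) = (u *\<^sub>R a + v *\<^sub>R b + w *\<^sub>R c) -
      (u' *\<^sub>R a + v' *\<^sub>R b + w' *\<^sub>R c) - a + b"
    using dist by (simp add: U_def algebra_simps)
  then have "(\<Sum>x\<in>{a, b, c}. U x *\<^sub>R x) = 0"
    unfolding 1(1)[symmetric] 2(1)[symmetric] by simp
  ultimately have "\<forall>x\<in>{a, b, c}. U x = 0"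
    using indep affine_dependent_explicit_finite[of "{a, b, c}"] by blast
  then have "U a = 0" "U b = 0" by simp_all
  then have "u - u' = 1" "v' - v = 1" using dist by (simp_all add: U_def)
  then have "u = 1 \<and> v = 0 \<and> w = 0" using 1 2 by linarith
  then show ?thesis using 1(1) by simp
qed

text \<open>A vertex of the triangle is an extreme point, so its segment part is an endpoint of the segment, and
the vertex stays in the triangle when moved along the whole segment in one of the two
directions. Two of the three vertices share the direction.\<close>

lemma triangle_no_segment_summand:
  fixes p q :: "'a::euclidean_space"
  assumes F: "2 simplex F" and sum: "F = convex hull {p, q} + G" and pq: "p \<noteq> q"
  shows False
proof -
  obtain C where C: "\<not> affine_dependent C" "int (card C) = 2 + 1" "F = convex hull C"
    using F unfolding simplex_def by blast
  have move: "x + (q - p) \<in> F \<or> x + (p - q) \<in> F" if "x \<in> C" for x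
  proof -
    have ext: "x extreme_point_of F"
      using C that extreme_point_of_convex_hull_affine_independent by blast
    then have "x \<in> F" by (simp add: extreme_point_of_def)
    then obtain s g where sg: "s \<in> closed_segment p q" "g \<in> G" "x = s + g"
      unfolding sum segment_convex_hull[symmetric] by (auto simp: set_plus_def)
    have mem: "p + g \<in> F" "q + g \<in> F"
      unfolding sum using sg(2) by (auto intro!: set_plus_intro hull_inc)
    have "s = p \<or> s = q"
    proof (rule ccontr)
      assume "\<not> (s = p \<or> s = q)"
      then have "s \<in> open_segment p q" using sg(1) by (simp add: open_segment_def)
      then have "x \<in> open_segment (p + g) (q + g)"
        using sg(3) open_segment_translation_eq[of g s p q] by (simp add: add.commute)
      then show False using ext mem by (auto simp: extreme_point_of_def)
    qed
    then show ?thesis using mem sg(3) by (auto simp: algebra_simps)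
  qed
  \<comment> \<open>\<open>triangle_translation_trivial\<close> for an arbitrary pair of vertices.\<close>
  have no: "d = 0" if "x \<in> C" "y \<in> C" "x \<noteq> y" "x + d \<in> F" "y + d \<in> F" for x y d
  proof -
    have "card (C - {x, y}) = 1"
      using C(2) that(1-3) by (subst card_Diff_subset) auto
    then obtain z where "C - {x, y} = {z}" by (auto simp: card_1_singleton_iff)
    then have "C = {x, y, z}" "x \<noteq> z" "y \<noteq> z" using that by auto
    then show ?thesis using triangle_translation_trivial[of x y z d] C that by blast
  qed
  have "card C = 3" using C(2) by simp
  then obtain a b c where abc: "C = {a, b, c}" "a \<noteq> b" "a \<noteq> c" "b \<noteq> c"
    by (auto simp: card_3_iff)
  have "q - p \<noteq> 0" "p - q \<noteq> 0" using pq by simp_all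
  then show False
    using move[of a] move[of b] move[of c] no[of a b] no[of a c] no[of b c] abc by blast
qed

lemma edge_of_triangle:
  fixes a b c :: "'a::euclidean_space"
  assumes "2 simplex (convex hull {a, b, c})"
  shows "convex hull {a, b} edge_of (convex hull {a, b, c})"
proof -
  have dim: "aff_dim {a, b, c} = 2" using aff_dim_simplex[OF assms] by (simp add: aff_dim_convex_hull)
  then have "card {a, b, c} = 3"
    using aff_dim_le_card[of "{a, b, c}"] card_insert_le_m1[of 3 "{b, c}" a]
      card_insert_le_m1[of 2 "{c}" b] by simp
  then have indep: "\<not> affine_dependent {a, b, c}"
    using dim affine_independent_iff_card[of "{a, b, c}"] by simp
  have "card {b, c} \<le> 2" using card_insert_le_m1[of 2 "{c}" b] by simp
  then have "a \<noteq> b" using \<open>card {a, b, c} = 3\<close> by (intro notI) simp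
  have "convex hull {a, b} face_of convex hull {a, b, c}"
    unfolding face_of_convex_hull_affine_independent[OF indep]
    by (intro exI[of _ "{a, b}"] conjI refl) simp
  then show ?thesis
    using \<open>a \<noteq> b\<close> by (simp add: edge_of_def aff_dim_convex_hull)
qed

section \<open>The dual Newton subdivision\<close>

text \<open>For \<open>P\<close> in sector \<open>k\<close> of \<open>u\<close>, the exponent of the only term that attains the maximum at \<open>- u\<close> in the polynomial
of the line dual to \<open>P\<close>.\<close>

definition exponent :: "3 \<Rightarrow> point" where
  "exponent k = (if k = 0 then (0, 1) else if k = 1 then (0, 0) else (1, 0))"

text \<open>The line dual to \<open>P\<close>, with vertex \<open>- P\<close>, is examined at \<open>- u\<close>; only the position of \<open>P\<close> relative to the
tropical line with vertex \<open>u\<close> matters.\<close>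

lemma max_exponents_eq:
  "max_exponents (fst P) (snd P) 0 (- u) =
    exponent ` {k. tcoord k P \<le> tcoord k u \<and> tcoord (k + 1) u \<le> tcoord (k + 1) P}"
  unfolding set_eq_iff image_iff Bex_def ex_three max_exponents_def Let_def mem_Collect_eq
  by (auto simp: exponent_def tcoord_def three_numerals max_def)

lemma max_exponents_sector:
  assumes "P \<in> sector k u"
  shows "max_exponents (fst P) (snd P) 0 (- u) = {exponent k}"
proof -
  have "tcoord i P \<le> tcoord i u \<and> tcoord (i + 1) u \<le> tcoord (i + 1) P \<longleftrightarrow> i = k" for i
    using three_cases[of i k] assms by (elim disjE) (simp_all add: sector_def)
  then show ?thesis by (simp add: max_exponents_eq)
qed

lemma max_exponents_ray:
  assumes "P \<in> ray k u"
  shows "max_exponents (fst P) (snd P) 0 (- u) = {exponent k, exponent (k + 2)}"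
proof -
  have "tcoord i P \<le> tcoord i u \<and> tcoord (i + 1) u \<le> tcoord (i + 1) P \<longleftrightarrow> i = k \<or> i = k + 2" for i
    using three_cases[of i k] assms tcoord_sum[of k P] tcoord_sum[of k u]
    by (elim disjE) (simp_all add: ray_def)
  then have "{i. tcoord i P \<le> tcoord i u \<and> tcoord (i + 1) u \<le> tcoord (i + 1) P} = {k, k + 2}" by auto
  then show ?thesis by (simp add: max_exponents_eq)
qed

lemma max_exponents_self: "max_exponents (fst u) (snd u) 0 (- u) = {exponent 0, exponent 1, exponent 2}"
  unfolding max_exponents_eq set_eq_iff image_iff Bex_def ex_three by auto

lemma exponent_inj: "exponent i = exponent j \<longleftrightarrow> i = j"
  using three_exhaust[of i] three_exhaust[of j] by (elim disjE) (simp_all add: exponent_def)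

lemma exponent_bounds: "0 \<le> fst (exponent k)" "0 \<le> snd (exponent k)" "fst (exponent k) + snd (exponent k) \<le> 1"
  by (simp_all add: exponent_def)

lemma newton_face_eq:
  "(\<Sum>L\<in>dual_arrangement S. dual_cell L w) =
    (\<Sum>P\<in>S. convex hull max_exponents (fst P) (snd P) 0 w)"
proof -
  have "inj_on (\<lambda>P. trop_line (- P)) S" by (auto simp: inj_on_def trop_line_inj)
  then show ?thesis
    unfolding dual_arrangement_def by (simp add: sum.reindex dual_cell_def)
qed

text \<open>A point of \<open>S\<close> on a ray of \<open>u\<close> contributes a segment to the Minkowski sum, which a triangle does not
admit. So the sum consists of single exponents and, as it is not a point, of the full unit
triangle contributed by \<open>u\<close> itself.\<close>

lemma triangular_newton_face:
  assumes fin: "finite S"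
    and F: "F = (\<Sum>P\<in>S. convex hull max_exponents (fst P) (snd P) 0 (- u))" and simplex: "2 simplex F"
  shows "u \<in> S \<and> isolated S u \<and> (\<exists>\<epsilon>. (\<forall>P\<in>S - {u}. \<exists>k. P \<in> sector k u \<and> \<epsilon> P = exponent k) \<and>
     (let n = (\<Sum>P\<in>S - {u}. \<epsilon> P) in F = convex hull ((\<lambda>k. n + exponent k) ` {0, 1, 2})))"
proof -
  let ?M = "\<lambda>P. max_exponents (fst P) (snd P) 0 (- u)"
  have iso: "isolated S u"
    unfolding isolated_def
  proof (intro allI equals0I)
    fix i P assume P: "P \<in> S \<inter> ray i u"
    then have "F = convex hull {exponent i, exponent (i + 2)} + (\<Sum>P\<in>S - {P}. convex hull ?M P)"
      using fin max_exponents_ray[of P i u] sum.remove[of S P "\<lambda>P. convex hull ?M P"]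
      unfolding F by simp
    then show False
      by (rule triangle_no_segment_summand[OF simplex]) (simp add: exponent_inj)
  qed
  have "\<exists>k. P \<in> sector k u" if "P \<in> S - {u}" for P
    using that iso ray_or_sector[of P u] by (auto simp: isolated_def)
  then obtain \<sigma> where \<sigma>: "\<And>P. P \<in> S - {u} \<Longrightarrow> P \<in> sector (\<sigma> P) u" by metis
  define n where "n = (\<Sum>P\<in>S - {u}. exponent (\<sigma> P))"
  have "(\<Sum>P\<in>S - {u}. convex hull ?M P) = (\<Sum>P\<in>S - {u}. {exponent (\<sigma> P)})"
  proof (rule sum.cong[OF refl])
    fix P assume "P \<in> S - {u}"
    then show "convex hull ?M P = {exponent (\<sigma> P)}"
      using max_exponents_sector[OF \<sigma>] by simp
  qed
  also have "\<dots> = {n}"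
    unfolding n_def using finite_Diff[OF fin, of "{u}"]
    by (induction rule: finite_induct) (simp_all add: set_plus_def)
  finally have rest: "(\<Sum>P\<in>S - {u}. convex hull ?M P) = {n}" .
  have uS: "u \<in> S"
  proof (rule ccontr)
    assume "u \<notin> S"
    then have "F = {n}" using rest F by simp
    then show False using simplex by simp
  qed
  have "F = convex hull ?M u + {n}"
    using fin uS rest F by (simp add: sum.remove)
  also have "\<dots> = convex hull ({n} + {exponent 0, exponent 1, exponent 2})"
    by (simp add: convex_hull_set_plus max_exponents_self add.commute)
  also have "{n} + {exponent 0, exponent 1, exponent 2} = (\<lambda>k. n + exponent k) ` {0, 1, 2}"
    by (simp add: set_plus_def) blast
  finally have "F = convex hull ((\<lambda>k. n + exponent k) ` {0, 1, 2})" .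
  then show ?thesis
    using uS iso \<sigma> unfolding n_def Let_def by (intro conjI exI[of _ "\<lambda>P. exponent (\<sigma> P)"]) auto
qed

lemma frontier_supporting_hyperplane:
  fixes a :: "'a::euclidean_space"
  assumes "N \<subseteq> {x. a \<bullet> x \<le> b}" "a \<noteq> 0" "w \<in> N" "a \<bullet> w = b"
  shows "w \<in> frontier N"
proof -
  have "interior N \<subseteq> {x. a \<bullet> x < b}"
    using interior_mono[OF assms(1)] assms(2) by simp
  then show ?thesis using assms closure_subset[of N] by (auto simp: frontier_def)
qed

lemma mem_newton_triangle:
  fixes m :: real
  assumes "0 \<le> fst z" "0 \<le> snd z" "fst z + snd z \<le> m" "0 < m"
  shows "z \<in> convex hull {(0, 0), (m, 0), (0, m)}"
proof -
  have "(fst z + snd z) / m \<le> 1" using assms by simp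
  then have "fst z / m + snd z / m \<le> 1" by (simp add: add_divide_distrib)
  then show ?thesis
    unfolding convex_hull_3 mem_Collect_eq using assms
    by (intro exI[of _ "1 - fst z / m - snd z / m"] exI[of _ "fst z / m"] exI[of _ "snd z / m"])
      (simp add: prod_eq_iff)
qed

lemma newton_triangle_halfspace:
  fixes m :: real
  assumes "a \<bullet> (0, 0) \<le> b" "a \<bullet> (m, 0) \<le> b" "a \<bullet> (0, m) \<le> b"
  shows "convex hull {(0, 0), (m, 0), (0, m)} \<subseteq> {x :: point. a \<bullet> x \<le> b}"
  using assms by (intro hull_minimal) (auto simp: convex_halfspace_le)

text \<open>A triangular face comes from an isolated point \<open>u\<close> and is a unit triangle translated by the sum \<open>n\<close> of the
exponents of the other points. If no other point has the exponent of sector \<open>i\<close>, then the side of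
the triangle opposite to the vertex \<open>n + exponent i\<close> lies on the side of the Newton polygon
opposite to the corner of that exponent.\<close>

lemma near_pencil_if_empty_sectors:
  assumes fin: "finite S"
    and empty: "\<And>P. P \<in> S \<Longrightarrow> isolated S P \<Longrightarrow> \<exists>i. S \<inter> sector i P = {}"
  shows "near_pencil S"
  unfolding near_pencil_def near_pencil_arrangement_def
proof (intro conjI ballI impI)
  show "trop_arrangement (dual_arrangement S)"
    using fin unfolding trop_arrangement_def dual_arrangement_def is_trop_line_def by blast
next
  fix F assume "F \<in> newton_faces (dual_arrangement S)" and simplex: "2 simplex F"
  then obtain w where w: "F = (\<Sum>P\<in>S. convex hull max_exponents (fst P) (snd P) 0 w)"
    unfolding newton_faces_def newton_face_eq by blast
  define u where "u = - w"
  have F: "F = (\<Sum>P\<in>S. convex hull max_exponents (fst P) (snd P) 0 (- u))"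
    using w by (simp add: u_def)
  obtain \<epsilon> where u: "u \<in> S" "isolated S u"
    and \<epsilon>: "\<And>P. P \<in> S - {u} \<Longrightarrow> \<exists>k. P \<in> sector k u \<and> \<epsilon> P = exponent k"
    and face: "F = convex hull ((\<lambda>k. (\<Sum>P\<in>S - {u}. \<epsilon> P) + exponent k) ` {0, 1, 2})"
    using triangular_newton_face[OF fin F simplex] unfolding Let_def by blast
  obtain i where i: "S \<inter> sector i u = {}" using empty u by blast
  define n where "n = (\<Sum>P\<in>S - {u}. \<epsilon> P)"
  define m where "m = real (card S)"
  have m: "m = real (card (S - {u})) + 1"
    unfolding m_def using card_Suc_Diff1[OF fin u(1)] by linarith
  have "card (dual_arrangement S) = card S"
    unfolding dual_arrangement_def by (intro card_image) (auto simp: inj_on_def trop_line_inj)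
  then have poly: "newton_polygon (dual_arrangement S) = convex hull {(0, 0), (m, 0), (0, m)}"
    by (simp add: newton_polygon_def m_def)
  have coords: "fst n = (\<Sum>P\<in>S - {u}. fst (\<epsilon> P))" "snd n = (\<Sum>P\<in>S - {u}. snd (\<epsilon> P))"
    by (simp_all add: n_def fst_sum snd_sum)
  have \<epsilon>': "\<exists>k. k \<noteq> i \<and> \<epsilon> P = exponent k" if P: "P \<in> S - {u}" for P
  proof -
    obtain k where k: "P \<in> sector k u" "\<epsilon> P = exponent k" using \<epsilon>[OF P] by blast
    then have "k \<noteq> i" using i P by auto
    then show ?thesis using k(2) by blast
  qed
  have n: "0 \<le> fst n" "0 \<le> snd n" "fst n + snd n \<le> real (card (S - {u}))"
  proof -
    have *: "0 \<le> fst (\<epsilon> P)" "0 \<le> snd (\<epsilon> P)" "fst (\<epsilon> P) + snd (\<epsilon> P) \<le> 1" if P: "P \<in> S - {u}" for P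
    proof -
      obtain k where "\<epsilon> P = exponent k" using \<epsilon>[OF P] by blast
      then show "0 \<le> fst (\<epsilon> P)" "0 \<le> snd (\<epsilon> P)" "fst (\<epsilon> P) + snd (\<epsilon> P) \<le> 1"
        by (simp_all only: exponent_bounds)
    qed
    show "0 \<le> fst n" "0 \<le> snd n" unfolding coords by (rule sum_nonneg; rule *; assumption)+
    have "(\<Sum>P\<in>S - {u}. fst (\<epsilon> P) + snd (\<epsilon> P)) \<le> of_nat (card (S - {u})) * 1"
      by (rule sum_bounded_above) (rule *(3))
    then show "fst n + snd n \<le> real (card (S - {u}))"
      unfolding coords sum.distrib[symmetric] by simp
  qed
  \<comment> \<open>The line \<open>h \<bullet> x = t\<close> supports the Newton polygon along one of its sides, and \<open>a\<close>, \<open>b\<close> are the indices other than \<open>i\<close>.\<close>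
  have edge: "\<exists>e. e edge_of F \<and> e \<subseteq> frontier (newton_polygon (dual_arrangement S))"
    if abc: "{a, b, c} = {0, 1, 2 :: 3}"
      and h: "h \<noteq> 0" "h \<bullet> (0, 0) \<le> t" "h \<bullet> (m, 0) \<le> t" "h \<bullet> (0, m) \<le> t"
      and on: "h \<bullet> (n + exponent a) = t" "h \<bullet> (n + exponent b) = t"
    for a b c and h :: point and t
  proof -
    let ?N = "newton_polygon (dual_arrangement S)"
    let ?e = "convex hull {n + exponent a, n + exponent b}"
    have Fabc: "F = convex hull {n + exponent a, n + exponent b, n + exponent c}"
      using face unfolding n_def[symmetric] abc[symmetric] by simp
    have vert: "n + exponent k \<in> ?N" for k
      unfolding poly using exponent_bounds[of k] n m by (intro mem_newton_triangle) simp_all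
    have "?e \<subseteq> ?N"
      using vert unfolding poly by (intro hull_minimal) auto
    moreover have "?e \<subseteq> {x. h \<bullet> x = t}"
      using on by (intro hull_minimal) (auto simp: convex_hyperplane)
    moreover have "?N \<subseteq> {x. h \<bullet> x \<le> t}"
      unfolding poly using h by (intro newton_triangle_halfspace)
    ultimately have "?e \<subseteq> frontier ?N"
      using frontier_supporting_hyperplane[of ?N h t] h(1) by blast
    moreover have "?e edge_of F"
      using edge_of_triangle simplex unfolding Fabc by blast
    ultimately show ?thesis by blast
  qed
  have perm_120: "{1, 2, 0} = {0, 1, 2 :: 3}" and perm_021: "{0, 2, 1} = {0, 1, 2 :: 3}"
    and perm_012: "{0, 1, 2} = {0, 1, 2 :: 3}"
    by (simp_all only: insert_commute)
  consider "i = 0" | "i = 1" | "i = 2" using three_exhaust by blast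
  then show "\<exists>e. e edge_of F \<and> e \<subseteq> frontier (newton_polygon (dual_arrangement S))"
  proof cases
    case 1
    have "snd (\<epsilon> P) = 0" if "P \<in> S - {u}" for P
      using \<epsilon>'[OF that] 1 by (auto simp: exponent_def)
    then have "snd n = 0" unfolding coords by simp
    then show ?thesis
      using m by (intro edge[OF perm_120, of "(0, -1)" 0]) (simp_all add: exponent_def inner_prod_def zero_prod_def)
  next
    case 2
    have "fst (\<epsilon> P) + snd (\<epsilon> P) = 1" if "P \<in> S - {u}" for P
      using \<epsilon>'[OF that] 2 by (auto simp: exponent_def)
    then have "fst n + snd n = real (card (S - {u}))"
      unfolding coords sum.distrib[symmetric] by simp
    then show ?thesis
      using m by (intro edge[OF perm_021, of "(1, 1)" m]) (simp_all add: exponent_def inner_prod_def zero_prod_def)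
  next
    case 3
    have "fst (\<epsilon> P) = 0" if P: "P \<in> S - {u}" for P
    proof -
      obtain k where k: "k \<noteq> 2" "\<epsilon> P = exponent k" using \<epsilon>'[OF P] 3 by blast
      then show ?thesis using three_exhaust[of k] by (elim disjE) (simp_all add: exponent_def)
    qed
    then have "fst n = 0" unfolding coords by simp
    then show ?thesis
      using m by (intro edge[OF perm_012, of "(-1, 0)" 0]) (simp_all add: exponent_def inner_prod_def zero_prod_def)
  qed
qed

theorem theorem1:
  fixes S :: "(real \<times> real) set" and v b :: nat
  assumes "finite S" and "card S = v" and "v \<ge> 4"
    and "b = card (stable_lines S)"
  shows "b \<ge> v - 3 \<and> (b = v - 3 \<longrightarrow> near_pencil S)"
proof (intro conjI impI)
  show "b \<ge> v - 3" using card_le_card_stable_lines(1)[OF assms(1)] assms by simp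
  assume "b = v - 3"
  then have "\<not> card S < card (stable_lines S) + 3" using assms by simp
  show "near_pencil S"
  proof (rule near_pencil_if_empty_sectors[OF assms(1)])
    fix P assume "P \<in> S" "isolated S P"
    then show "\<exists>i. S \<inter> sector i P = {}"
      using card_le_card_stable_lines(2)[OF assms(1)] \<open>\<not> card S < card (stable_lines S) + 3\<close> by blast
  qed
qed

end
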